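(* Let $\mathfrak{f} \in \mathbb{R}^{N \times 1 \times M}$ be arbitrary. Let $\mathcal{U} \in \mathbb{R}^{N \times n \times M}$ be an orthogonal third-order tensor, in the sense that $\mathcal{U}^{T} * \mathcal{U} = \mathcal{I}_{n}$ (the $n \times n \times M$ identity tensor), and let $\mathcal{P} \in \mathbb{R}^{N \times n \times M}$ be a sampling tensor such that $\mathcal{P}^{T} * \mathcal{U} \in \mathbb{R}^{n \times n \times M}$ is invertible with respect to the t-product. Define the t-Q-DEIM approximation of $\mathfrak{f}$ by $$\mathfrak{f}_{\mathrm{tq}} := \mathcal{U} * (\mathcal{P}^{T} * \mathcal{U})^{-1} * \mathcal{P}^{T} * \mathfrak{f} \in \mathbb{R}^{N \times 1 \times M}.$$ Then, in the t-spectral norm $\|\cdot\|$, $$\|\mathfrak{f} - \mathfrak{f}_{\mathrm{tq}}\| \;\le\; \big\|(\mathcal{P}^{T} * \mathcal{U})^{-1}\big\| \cdot \big\|(\mathcal{I} - \mathcal{U} * \mathcal{U}^{T}) * \mathfrak{f}\big\|,$$ where $\mathcal{I} \in \mathbb{R}^{N \times N \times M}$ is the identity tensor.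
   Context: For a third-order tensor $\mathcal{A} \in \mathbb{R}^{m \times \ell \times q}$, write $\mathbf{A}^{(k)} := \mathcal{A}(:,:,k) \in \mathbb{R}^{m \times \ell}$, $k=1,\dots,q$, for its frontal slices. Block circulant matrix: $\mathrm{bcirc}(\mathcal{A}) \in \mathbb{R}^{mq \times \ell q}$ is the $q \times q$ block matrix whose $(a,b)$ block is $\mathbf{A}^{(((a-b) \bmod q)+1)}$ (so the first block column is $\mathbf{A}^{(1)}, \mathbf{A}^{(2)}, \dots, \mathbf{A}^{(q)}$ from top to bottom). The operation $\mathrm{unfold}(\mathcal{A}) \in \mathbb{R}^{mq \times \ell}$ stacks $\mathbf{A}^{(1)}, \dots, \mathbf{A}^{(q)}$ vertically, and $\mathrm{fold}$ is its inverse. t-product: for $\mathcal{A} \in \mathbb{R}^{m \times \ell \times q}$ and $\mathcal{B} \in \mathbb{R}^{\ell \times r \times q}$, $\mathcal{A} * \mathcal{B} := \mathrm{fold}(\mathrm{bcirc}(\mathcal{A}) \cdot \mathrm{unfold}(\mathcal{B})) \in \mathbb{R}^{m \times r \times q}$. Transpose: $\mathcal{A}^{T} \in \mathbb{R}^{\ell \times m \times q}$ is obtained by transposing each frontal slice and then reversing the order of the transposed slices $2$ through $q$. Identity tensor (size $m \times m \times q$): first frontal slice is the $m \times m$ identity matrix, all other frontal slices are zero. A tensor $\mathcal{A} \in \mathbb{R}^{m \times m \times q}$ is invertible if there is $\mathcal{B} \in \mathbb{R}^{m \times m \times q}$ with $\mathcal{A} * \mathcal{B} = \mathcal{B} * \mathcal{A}$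 equal to the identity tensor; then $\mathcal{A}^{-1} := \mathcal{B}$. Sampling tensor: a tensor $\mathcal{P} \in \mathbb{R}^{N \times n \times M}$ whose first frontal slice has as its columns $n$ distinct columns $p_1, \dots, p_n$ of the $N \times N$ identity matrix, and whose remaining frontal slices are zero (so $\mathcal{P}^{T} * \mathfrak{f}$ selects the horizontal slices $p_1,\dots,p_n$ of $\mathfrak{f}$). t-spectral norm: $\|\mathcal{A}\| := \|\mathrm{bcirc}(\mathcal{A})\|_2$, the matrix spectral norm of the block circulant matrix. *)

theory Defs
  imports
    "HOL-Analysis.Analysis"
    "Berlekamp_Zassenhaus.Finite_Field"
begin

text \<open>
  A tensor in \<open>R^(m x l x q)\<close> is the family of its frontal slices, indexed by the residues modulo
  \<open>q = CARD('q)\<close>: residue \<open>k\<close> (\<open>0 \<le> k < q\<close>) holds the slice numbered \<open>k + 1\<close>. Index arithmetic is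
  thereby modulo \<open>q\<close>. The type \<open>'q mod_ring\<close> has \<open>CARD('q)\<close> elements for every finite \<open>'q\<close>.
\<close>

type_synonym ('m, 'l, 'q) tensor = "real ^ 'l ^ 'm ^ ('q mod_ring)"

text \<open>Row \<open>(a, i)\<close> of a block matrix is row \<open>i\<close> of block row \<open>a\<close>; likewise for columns.\<close>

definition bcirc ::
  "('m::finite, 'l::finite, 'q::finite) tensor \<Rightarrow> real ^ ('q mod_ring \<times> 'l) ^ ('q mod_ring \<times> 'm)"
  where "bcirc A = (\<chi> r c. A $ (fst r - fst c) $ snd r $ snd c)"

definition tunfold ::
  "('m::finite, 'l::finite, 'q::finite) tensor \<Rightarrow> real ^ 'l ^ ('q mod_ring \<times> 'm)"
  where "tunfold A = (\<chi> r. A $ fst r $ snd r)"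

definition tfold ::
  "real ^ 'l ^ ('q mod_ring \<times> 'm) \<Rightarrow> ('m::finite, 'l::finite, 'q::finite) tensor"
  where "tfold X = (\<chi> k i. X $ (k, i))"

lemma tfold_tunfold [simp]: "tfold (tunfold A) = A"
  by (simp add: tfold_def tunfold_def vec_eq_iff)

lemma tunfold_tfold [simp]: "tunfold (tfold X) = X"
  by (simp add: tfold_def tunfold_def vec_eq_iff)

definition tprod ::
  "('m::finite, 'l::finite, 'q::finite) tensor \<Rightarrow> ('l, 'r::finite, 'q) tensor \<Rightarrow> ('m, 'r, 'q) tensor"
  (infixl "*\<^sub>t" 70)
  where "A *\<^sub>t B = tfold (bcirc A ** tunfold B)"

text \<open>Reversing slices \<open>2, ..., q\<close> and keeping slice \<open>1\<close> is negation of residues.\<close>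

definition ttranspose ::
  "('m::finite, 'l::finite, 'q::finite) tensor \<Rightarrow> ('l, 'm, 'q) tensor"
  where "ttranspose A = (\<chi> k. transpose (A $ (- k)))"

definition tid :: "('m::finite, 'm, 'q::finite) tensor"
  where "tid = (\<chi> k. if k = 0 then mat 1 else 0)"

definition tinvertible :: "('m::finite, 'm, 'q::finite) tensor \<Rightarrow> bool"
  where "tinvertible A \<longleftrightarrow> (\<exists>B. A *\<^sub>t B = tid \<and> B *\<^sub>t A = tid)"

definition tinverse :: "('m::finite, 'm, 'q::finite) tensor \<Rightarrow> ('m, 'm, 'q) tensor"
  where "tinverse A = (THE B. A *\<^sub>t B = tid \<and> B *\<^sub>t A = tid)"

definition sampling_tensor :: "('N::finite, 'n::finite, 'M::finite) tensor \<Rightarrow> bool"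
  where "sampling_tensor P \<longleftrightarrow>
    (\<exists>p :: 'n \<Rightarrow> 'N. inj p \<and> (\<forall>j. column j (P $ 0) = column (p j) (mat 1))) \<and>
    (\<forall>k. k \<noteq> 0 \<longrightarrow> P $ k = 0)"

definition tnorm :: "('m::finite, 'l::finite, 'q::finite) tensor \<Rightarrow> real"
  where "tnorm A = onorm ((*v) (bcirc A))"

definition tq_deim ::
  "('N::finite, 'n::finite, 'M::finite) tensor \<Rightarrow> ('N, 'n, 'M) tensor \<Rightarrow>
   ('N, 1, 'M) tensor \<Rightarrow> ('N, 1, 'M) tensor"
  where "tq_deim U P f = U *\<^sub>t tinverse (ttranspose P *\<^sub>t U) *\<^sub>t ttranspose P *\<^sub>t f"

end

theory Submission
  imports Defs
begin

text \<open>
  The map \<open>bcirc\<close> is a homomorphism from the t-product to the matrix product, so it suffices to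
  argue with matrices. Let \<open>A = P\<^sup>T U\<close> have inverse \<open>G\<close>, and let \<open>v\<close> be the error of the
  approximation applied to a vector. Then \<open>P\<^sup>T v = 0\<close>, and \<open>r = (I - U U\<^sup>T) v\<close> is the
  projection error. With \<open>z = U\<^sup>T v\<close>, the norm of \<open>z\<close> squared equals the inner product of
  \<open>v\<close> and \<open>(I - P P\<^sup>T) U z\<close>, and the norm of the latter vector squared is
  \<open>|z|\<^sup>2 - |A z|\<^sup>2 \<le> (1 - 1/|G|\<^sup>2) |z|\<^sup>2\<close>. Cauchy-Schwarz gives
  \<open>|z|\<^sup>2 \<le> (1 - 1/|G|\<^sup>2) |v|\<^sup>2\<close>, hence \<open>|r|\<^sup>2 = |v|\<^sup>2 - |z|\<^sup>2 \<ge> |v|\<^sup>2 / |G|\<^sup>2\<close>.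
\<close>

lemma bcirc_nth: "bcirc A $ r $ c = A $ (fst r - fst c) $ snd r $ snd c"
  by (simp add: bcirc_def)

lemma tprod_nth: "(A *\<^sub>t B) $ k $ i $ j =
    (\<Sum>s\<in>UNIV. A $ (k - fst s) $ i $ snd s * B $ fst s $ snd s $ j)"
  by (simp add: tprod_def tfold_def matrix_matrix_mult_def bcirc_nth tunfold_def)

lemma bcirc_tprod: "bcirc (A *\<^sub>t B) = bcirc A ** bcirc B"
proof -
  have "bcirc (A *\<^sub>t B) $ r $ c = (bcirc A ** bcirc B) $ r $ c" for r c
    unfolding bcirc_nth tprod_nth matrix_matrix_mult_def vec_lambda_beta
    \<comment> \<open>The t-product counts block indices relative to block column
      \<open>fst c\<close>, the matrix product counts them absolutely; the witnesses shift by
      \<open>fst c\<close>.\<close>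
    by (rule sum.reindex_bij_witness[where i = "\<lambda>s. (fst s - fst c, snd s)"
          and j = "\<lambda>s. (fst s + fst c, snd s)"])
       (auto simp: algebra_simps)
  then show ?thesis
    by (simp add: vec_eq_iff)
qed

lemma bcirc_tid: "bcirc tid = mat 1"
  by (auto simp: vec_eq_iff bcirc_nth tid_def mat_def prod_eq_iff)

lemma bcirc_ttranspose: "bcirc (ttranspose A) = transpose (bcirc A)"
  by (simp add: vec_eq_iff bcirc_nth ttranspose_def transpose_def)

lemma bcirc_diff: "bcirc (A - B) = bcirc A - bcirc B"
  by (simp add: vec_eq_iff bcirc_nth)

lemma bcirc_inject: "bcirc A = bcirc B \<longleftrightarrow> A = B"
proof
  assume "bcirc A = bcirc B"
  \<comment> \<open>Block column 0 already lists all frontal slices.\<close>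
  then have "bcirc A $ (k, i) $ (0, j) = bcirc B $ (k, i) $ (0, j)" for k i j
    by simp
  then show "A = B"
    by (simp add: vec_eq_iff bcirc_nth)
qed simp

lemma tinverse:
  assumes "tinvertible A"
  shows "A *\<^sub>t tinverse A = tid" and "tinverse A *\<^sub>t A = tid"
proof -
  obtain B where B: "A *\<^sub>t B = tid \<and> B *\<^sub>t A = tid"
    using assms by (auto simp: tinvertible_def)
  \<comment> \<open>\<open>THE\<close> needs uniqueness. The usual argument C = (BA)C = B(AC) = B
    runs on the matrix side, where associativity is available.\<close>
  have "C = B" if C: "A *\<^sub>t C = tid \<and> C *\<^sub>t A = tid" for C
  proof -
    have "bcirc C = bcirc (B *\<^sub>t A) ** bcirc C"
      using B by (simp add: bcirc_tid)
    also have "\<dots> = bcirc B ** bcirc (A *\<^sub>t C)"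
      by (simp add: bcirc_tprod matrix_mul_assoc)
    also have "\<dots> = bcirc B"
      using C by (simp add: bcirc_tid)
    finally show ?thesis
      by (simp add: bcirc_inject)
  qed
  with B have "A *\<^sub>t tinverse A = tid \<and> tinverse A *\<^sub>t A = tid"
    unfolding tinverse_def by (rule theI)
  then show "A *\<^sub>t tinverse A = tid" and "tinverse A *\<^sub>t A = tid"
    by auto
qed

lemma sampling_tensor_orthonormal:
  fixes P :: "('N::finite, 'n::finite, 'M::finite) tensor"
  assumes "sampling_tensor P"
  shows "transpose (bcirc P) ** bcirc P = mat 1"
proof -
  obtain p :: "'n \<Rightarrow> 'N" where p: "inj p" "\<And>j. column j (P $ 0) = column (p j) (mat 1)"
    and P: "\<And>k. k \<noteq> 0 \<Longrightarrow> P $ k = 0"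
    using assms by (auto simp: sampling_tensor_def)
  have P0: "P $ 0 $ i $ j = (if i = p j then 1 else 0)" for i j
    using p(2)[of j] by (simp add: column_def mat_def vec_eq_iff)
  \<comment> \<open>Each column of \<open>bcirc P\<close> is a unit vector; since \<open>p\<close>
    is injective, distinct columns have their 1 in distinct rows.\<close>
  have entry: "bcirc P $ r $ c = (if r = (fst c, p (snd c)) then 1 else 0)" for r c
    by (cases "fst r = fst c") (auto simp: bcirc_nth P0 P prod_eq_iff)
  have "(transpose (bcirc P) ** bcirc P) $ c $ d = mat 1 $ c $ d" for c d
  proof -
    have "(transpose (bcirc P) ** bcirc P) $ c $ d =
        (\<Sum>r\<in>UNIV. if r = (fst c, p (snd c)) then if r = (fst d, p (snd d)) then 1 else 0 else 0)"
      unfolding matrix_matrix_mult_def transpose_def vec_lambda_beta entry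
      by (rule sum.cong) auto
    also have "\<dots> = mat 1 $ c $ d"
      unfolding sum.delta[OF finite] using p(1) by (simp add: mat_def prod_eq_iff inj_eq)
    finally show ?thesis .
  qed
  then show ?thesis
    by (simp add: vec_eq_iff)
qed

lemma norm_orthonormal_columns:
  fixes U :: "real ^ 'n ^ 'm"
  assumes "transpose U ** U = mat 1"
  shows "norm (U *v x) = norm x"
  by (simp add: norm_eq_sqrt_inner inner_commute dot_lmul_matrix[symmetric]
      matrix_vector_mul_assoc assms flip: transpose_matrix_vector)

text \<open>Pythagoras: \<open>U ** transpose U\<close> is the orthogonal projection onto the column
  space of \<open>U\<close>. It serves for both the basis and the sampling matrix.\<close>

lemma norm_orthogonal_residual:
  fixes U :: "real ^ 'n ^ 'm"
  assumes "transpose U ** U = mat 1"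
  shows "(norm (w - U *v (transpose U *v w)))\<^sup>2 = (norm w)\<^sup>2 - (norm (transpose U *v w))\<^sup>2"
proof -
  have "w \<bullet> (U *v (transpose U *v w)) = (norm (transpose U *v w))\<^sup>2"
    by (simp add: power2_norm_eq_inner dot_lmul_matrix[symmetric])
  then show ?thesis
    using norm_orthonormal_columns[OF assms, of "transpose U *v w"]
    by (simp add: power2_norm_eq_inner norm_eq inner_diff inner_commute)
qed

text \<open>The singular values of \<open>transpose P ** U\<close> are the cosines of the principal
  angles between the column spaces of \<open>U\<close> and \<open>P\<close>, the smallest being
  1/|G|. So a vector orthogonal to the columns of \<open>P\<close> cannot lie too close to the
  column space of \<open>U\<close>.\<close>

lemma norm_le_inverse_times_residual:
  fixes U P :: "real ^ 'n ^ 'm"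
  assumes U: "transpose U ** U = mat 1" and P: "transpose P ** P = mat 1"
    and G: "G ** (transpose P ** U) = mat 1"
    and v: "transpose P *v v = 0"
  shows "norm v \<le> onorm ((*v) G) * norm (v - U *v (transpose U *v v))"
proof -
  define g where "g = onorm ((*v) G)"
  define z where "z = transpose U *v v"
  define A where "A = transpose P ** U"
  define w where "w = U *v z"
  define s where "s = w - P *v (transpose P *v w)"
  have g0: "g \<ge> 0"
    unfolding g_def by (rule onorm_pos_le) simp
  have Aw: "transpose P *v w = A *v z"
    by (simp add: w_def A_def matrix_vector_mul_assoc)
  have lower: "norm y \<le> g * norm (A *v y)" for y
  proof -
    have "norm y = norm (G *v (A *v y))"
      using G by (simp add: A_def matrix_vector_mul_assoc)
    also have "\<dots> \<le> g * norm (A *v y)"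
      unfolding g_def by (rule onorm) simp
    finally show ?thesis .
  qed
  have "(norm z)\<^sup>2 = v \<bullet> w"
    by (simp add: z_def w_def power2_norm_eq_inner dot_lmul_matrix[symmetric])
  \<comment> \<open>Since \<open>v\<close> is orthogonal to the columns of \<open>P\<close>,
    removing the projection of \<open>w\<close> onto them changes nothing.\<close>
  also have "\<dots> = v \<bullet> s"
    using v by (simp add: s_def inner_diff dot_lmul_matrix[symmetric])
  also have "\<dots> \<le> norm v * norm s"
    by (rule norm_cauchy_schwarz)
  finally have "((norm z)\<^sup>2)\<^sup>2 \<le> (norm v * norm s)\<^sup>2"
    by (intro power_mono) auto
  also have "\<dots> = (norm v)\<^sup>2 * ((norm z)\<^sup>2 - (norm (A *v z))\<^sup>2)"
    using norm_orthogonal_residual[OF P, of w] norm_orthonormal_columns[OF U, of z] Aw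
    by (simp add: s_def power_mult_distrib flip: w_def)
  finally have cs: "((norm z)\<^sup>2)\<^sup>2 \<le> (norm v)\<^sup>2 * ((norm z)\<^sup>2 - (norm (A *v z))\<^sup>2)" .
  have "(norm z)\<^sup>2 \<le> (g * norm (A *v z))\<^sup>2"
    using lower by (intro power_mono) auto
  then have "(norm v)\<^sup>2 * (norm z)\<^sup>2 \<le> (norm v)\<^sup>2 * (g\<^sup>2 * (norm (A *v z))\<^sup>2)"
    by (intro mult_left_mono) (auto simp: power_mult_distrib)
  moreover have "g\<^sup>2 * ((norm z)\<^sup>2)\<^sup>2 \<le> g\<^sup>2 * ((norm v)\<^sup>2 * ((norm z)\<^sup>2 - (norm (A *v z))\<^sup>2))"
    using cs by (intro mult_left_mono) auto
  \<comment> \<open>Adding the two inequalities cancels the terms with \<open>A *v z\<close> and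
    leaves a common factor |z|^2.\<close>
  ultimately have "(norm z)\<^sup>2 * (norm v)\<^sup>2 \<le> (norm z)\<^sup>2 * (g\<^sup>2 * ((norm v)\<^sup>2 - (norm z)\<^sup>2))"
    by (simp add: algebra_simps power2_eq_square)
  \<comment> \<open>Needed when z = 0, where that factor cannot be cancelled. It holds because
    \<open>A\<close> is a contraction, so its inverse cannot shrink every vector.\<close>
  moreover have "1 \<le> g"
  proof -
    obtain y :: "real ^ 'n" where y: "norm y = 1"
      using vector_choose_size[of 1] by auto
    have "(norm (A *v y))\<^sup>2 \<le> (norm (U *v y))\<^sup>2"
      using norm_orthogonal_residual[OF P, of "U *v y"]
        zero_le_power2[of "norm (U *v y - P *v (transpose P *v (U *v y)))"]
      by (simp add: A_def matrix_vector_mul_assoc)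
    then have "norm (A *v y) \<le> 1"
      using norm_orthonormal_columns[OF U, of y] y power2_le_imp_le[of "norm (A *v y)" 1] by simp
    then show ?thesis
      using lower[of y] y g0 mult_left_le[of "norm (A *v y)" g] by linarith
  qed
  ultimately have "(norm v)\<^sup>2 \<le> g\<^sup>2 * ((norm v)\<^sup>2 - (norm z)\<^sup>2)"
  proof (cases "z = 0")
    case True
    have "1 * (norm v)\<^sup>2 \<le> g\<^sup>2 * (norm v)\<^sup>2"
      using \<open>1 \<le> g\<close> by (intro mult_right_mono) auto
    then show ?thesis
      using True by simp
  qed simp
  also have "\<dots> = (g * norm (v - U *v (transpose U *v v)))\<^sup>2"
    using norm_orthogonal_residual[OF U, of v] by (simp add: power_mult_distrib z_def)
  finally have "norm v \<le> g * norm (v - U *v (transpose U *v v))"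
    by (rule power2_le_imp_le) (simp add: g0)
  then show ?thesis
    by (simp only: g_def)
qed

theorem theorem3p5:
  fixes f :: "('N::finite, 1, 'M::finite) tensor"
    and U P :: "('N, 'n::finite, 'M) tensor"
  assumes "ttranspose U *\<^sub>t U = tid"
    and "sampling_tensor P"
    and "tinvertible (ttranspose P *\<^sub>t U)"
  shows "tnorm (f - tq_deim U P f)
    \<le> tnorm (tinverse (ttranspose P *\<^sub>t U)) * tnorm ((tid - U *\<^sub>t ttranspose U) *\<^sub>t f)"
proof -
  define u where "u = bcirc U"
  define p where "p = bcirc P"
  define G where "G = bcirc (tinverse (ttranspose P *\<^sub>t U))"
  define F where "F = bcirc f"
  define R where "R = bcirc ((tid - U *\<^sub>t ttranspose U) *\<^sub>t f)"
  have u: "transpose u ** u = mat 1"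
    using assms(1) by (metis bcirc_tid bcirc_tprod bcirc_ttranspose u_def)
  have p: "transpose p ** p = mat 1"
    unfolding p_def by (rule sampling_tensor_orthonormal[OF assms(2)])
  have GA: "G ** (transpose p ** u) = mat 1" and AG: "(transpose p ** u) ** G = mat 1"
    using tinverse[OF assms(3)] unfolding G_def p_def u_def
    by (metis bcirc_tid bcirc_tprod bcirc_ttranspose)+
  have E: "bcirc (f - tq_deim U P f) = F - u ** G ** transpose p ** F"
    by (simp add: tq_deim_def bcirc_diff bcirc_tprod bcirc_ttranspose F_def u_def p_def G_def)
  have R: "R = (mat 1 - u ** transpose u) ** F"
    by (simp add: R_def bcirc_diff bcirc_tprod bcirc_ttranspose bcirc_tid F_def u_def)
  have "norm (bcirc (f - tq_deim U P f) *v x) \<le> onorm ((*v) G) * onorm ((*v) R) * norm x" for x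
  proof -
    define y where "y = F *v x"
    define c where "c = G *v (transpose p *v y)"
    define v where "v = y - u *v c"
    have Ev: "bcirc (f - tq_deim U P f) *v x = v"
      by (simp add: E v_def c_def y_def matrix_vector_mult_diff_rdistrib matrix_vector_mul_assoc
          matrix_mul_assoc)
    have "transpose p *v (u *v c) = ((transpose p ** u) ** G) *v (transpose p *v y)"
      by (simp add: c_def matrix_vector_mul_assoc matrix_mul_assoc)
    then have pv: "transpose p *v v = 0"
      by (simp add: v_def matrix_vector_mult_diff_distrib AG)
    have "transpose u *v (u *v c) = c"
      by (simp add: matrix_vector_mul_assoc u)
    \<comment> \<open>The error \<open>v\<close> differs from \<open>y\<close> by a vector in the
      column space of \<open>u\<close>, so both have the same projection residual.\<close>
    then have "v - u *v (transpose u *v v) = y - u *v (transpose u *v y)"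
      by (simp add: v_def matrix_vector_mult_diff_distrib)
    also have "\<dots> = R *v x"
      by (simp add: R y_def matrix_vector_mult_diff_rdistrib flip: matrix_vector_mul_assoc)
    finally have "norm v \<le> onorm ((*v) G) * norm (R *v x)"
      using norm_le_inverse_times_residual[OF u p GA pv] by simp
    also have "\<dots> \<le> onorm ((*v) G) * (onorm ((*v) R) * norm x)"
      by (intro mult_left_mono onorm onorm_pos_le) simp_all
    finally show ?thesis
      by (simp add: Ev mult.assoc)
  qed
  then show ?thesis
    unfolding tnorm_def G_def[symmetric] R_def[symmetric] by (rule onorm_le)
qed

end
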